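(* For every $n\ge 2$, one has $$R_n(\pi/2)\le \overline{R}_n(\pi/2)\le 2R_n(\pi/2).$$ Let $0<\phi<\tau\le\pi$ be any choice of constants such that $\sqrt{2}\,\sin(\phi/2)=\sin(\tau/2)$, and let $\phi_0=\arccos(3/4)$. Then for every $n \ge 2$ $$\max\left\{\left\lfloor\frac{K_{n-1}(2\phi_0)}{2}\right\rfloor,\ K_{n-1}(\phi,\tau)\right\}\le R_n(\pi/2)\le K_{n-1}(\phi_0)+2.$$
   Context: Spherical codes. For $x,y$ in the unit sphere $\mathbb{S}^{d-1}\subset\mathbb{R}^d$, let $\phi(x,y)\in[0,\pi]$ be the angle with $\cos\phi(x,y)=x\cdot y$. For $0<\phi\le\tau\le\pi$, $K_d(\phi,\tau)$ is the maximal cardinality of a subset $\mathcal{S}\subset\mathbb{S}^{d-1}$ such that $\phi\le\phi(x,y)\le\tau$ for all distinct $x,y\in\mathcal{S}$; set $K_d(\phi)=K_d(\phi,\pi)$. Hyperbolic codes. Write elements of $\mathbb{R}^n\perp\mathbb{R}$ as $(v;u)$ with $v\in\mathbb{R}^n$, $u\in\mathbb{R}$, and set $I((v;u),(v';u'))=-\langle v,v'\rangle+uu'$, where $\langle\ ,\ \rangle$ is the Euclidean inner product. The hyperboloid model of hyperbolic $n$-space is $L^n=\{q=(v;u): I(q,q)=1,\ u>0\}$. Projection from $(\underline{0};-1)$, $\pi(v;u)=v/(1+u)$, identifies $L^n$ with the open unit ball $B^n\subset\mathbb{R}^n$, with ideal boundary $\mathbb{S}^{n-1}$. A vector $w\in\mathbb{R}^n\perp\mathbb{R}$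 is negative if $I(w,w)<0$. For such $w$ set $Y(w)=\{\pi(q): q\in L^n,\ I(w,q)\le 0\}$ (a closed geodesic half-space) and $W(w)=\{\pi(q): q\in L^n,\ I(w,q)=0\}$ (its boundary), and let $\overline{Y}(w)$, $\overline{W}(w)$ be obtained by adjoining the ideal boundary points in $\mathbb{S}^{n-1}$. For negative $w_1,w_2$: if $\overline{W}(w_1)\cap\overline{W}(w_2)\neq\emptyset$, then $\theta(w_1,w_2)\in[0,\pi]$ is the angle between the outward unit normals to $Y(w_1)$ and $Y(w_2)$ at a common point, given by $\cos\theta(w_1,w_2)=-I(w_1,w_2)/\sqrt{I(w_1,w_1)I(w_2,w_2)}$; if $\overline{W}(w_1)\cap\overline{W}(w_2)=\emptyset$, then $\theta(w_1,w_2)=-\infty$. A hyperbolic code is a set $\mathcal{S}$ of negative vectors of $\mathbb{R}^n\perp\mathbb{R}$; it is strict if $\bigcup_{w\in\mathcal{S}}Y(w)\ne B^n$. Its angle $\theta(\mathcal{S})$ is the greatest lower bound in $\{-\infty\}\cup[0,\pi]$ of $\theta(w_1,w_2)$ over distinct $w_1,w_2\in\mathcal{S}$. For $0<\theta\le\pi$, the hyperbolic kissing number $\overline{R}_n(\theta)$ (resp. strict hyperbolic kissing number $R_n(\theta)$) in $\mathbb{Z}\cup\{\infty\}$ is the supremum of $\#\mathcal{S}$ over all hyperbolic codes (resp. all strict hyperbolic codes) $\mathcal{S}\subset\mathbb{R}^n\perp\mathbb{R}$ with $\theta(\mathcal{S})\ge\theta$. *)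

theory Defs
  imports "HOL-Analysis.Analysis"
begin

section \<open>Spherical codes\<close>

definition sph_angle :: "real ^ 'd \<Rightarrow> real ^ 'd \<Rightarrow> real" where
  "sph_angle x y = arccos (x \<bullet> y)"

definition spherical_code :: "real \<Rightarrow> real \<Rightarrow> (real ^ 'd) set \<Rightarrow> bool" where
  "spherical_code \<phi> \<tau> S \<longleftrightarrow>
     S \<subseteq> sphere 0 1 \<and> (\<forall>x\<in>S. \<forall>y\<in>S. x \<noteq> y \<longrightarrow> \<phi> \<le> sph_angle x y \<and> sph_angle x y \<le> \<tau>)"

text \<open>
  \<open>sph_max TYPE('d) \<phi> \<tau>\<close> is $K_d(\phi,\tau)$ with \<open>d = CARD('d)\<close>. The maximum
  exists, and no code is infinite, whenever \<open>0 < \<phi> \<le> \<pi>\<close>; see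
  \<open>spherical_code_bounded\<close> and \<open>sph_max_attained\<close> below.
\<close>
definition sph_max :: "'d::finite itself \<Rightarrow> real \<Rightarrow> real \<Rightarrow> nat" where
  "sph_max _ \<phi> \<tau> = Max {card S | S :: (real ^ 'd) set. spherical_code \<phi> \<tau> S}"

abbreviation sph_max_ge :: "'d::finite itself \<Rightarrow> real \<Rightarrow> nat" where
  "sph_max_ge d \<phi> \<equiv> sph_max d \<phi> pi"

lemma spherical_code_bounded:
  assumes "0 < \<phi>" "\<phi> \<le> pi"
  obtains N where "\<And>S :: (real ^ 'd) set. spherical_code \<phi> \<tau> S \<Longrightarrow> finite S \<and> card S \<le> N"
proof -
  define \<delta> where "\<delta> = sqrt (2 - 2 * cos \<phi>) / 2"
  have "cos \<phi> < cos 0"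
    using assms by (intro cos_monotone_0_pi) auto
  then have \<delta>: "\<delta> > 0"
    by (simp add: \<delta>_def)
  have "compact (sphere 0 1 :: (real ^ 'd) set)"
    by simp
  then obtain F :: "(real ^ 'd) set" where F: "finite F" "sphere 0 1 \<subseteq> (\<Union>c\<in>F. ball c \<delta>)"
    using \<delta> unfolding compact_eq_totally_bounded by meson
  have "finite S \<and> card S \<le> card F" if S: "spherical_code \<phi> \<tau> S" for S :: "(real ^ 'd) set"
  proof -
    have "\<exists>c\<in>F. x \<in> ball c \<delta>" if "x \<in> S" for x
      using F(2) S that unfolding spherical_code_def by blast
    then obtain f where f: "\<And>x. x \<in> S \<Longrightarrow> f x \<in> F \<and> x \<in> ball (f x) \<delta>"
      by metis
    have "inj_on f S"
    proof (rule inj_onI, rule ccontr)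
      fix x y assume xy: "x \<in> S" "y \<in> S" "f x = f y" "x \<noteq> y"
      have n: "norm x = 1" "norm y = 1" and a: "\<phi> \<le> arccos (x \<bullet> y)"
        using S xy by (auto simp: spherical_code_def sph_angle_def)
      have b: "\<bar>x \<bullet> y\<bar> \<le> 1"
        using Cauchy_Schwarz_ineq2[of x y] n by simp
      have "x \<bullet> y \<le> cos \<phi>"
        using cos_monotone_0_pi_le[of \<phi> "arccos (x \<bullet> y)"] a b assms arccos_ubound[of "x \<bullet> y"]
        by (simp add: abs_le_iff)
      moreover have "(norm (x - y))\<^sup>2 = 2 - 2 * (x \<bullet> y)"
        using n by (simp add: power2_norm_eq_inner inner_diff_left inner_diff_right
            inner_commute norm_eq_1)
      ultimately have "sqrt (2 - 2 * cos \<phi>) \<le> norm (x - y)"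
        by (intro real_le_lsqrt) simp_all
      then have "2 * \<delta> \<le> dist x y"
        by (simp add: \<delta>_def dist_norm)
      moreover have "dist x y < 2 * \<delta>"
        using f[OF xy(1)] f[OF xy(2)] xy(3) dist_triangle2[of x y "f x"]
        by (simp add: dist_commute)
      ultimately show False by simp
    qed
    moreover have "f ` S \<subseteq> F"
      using f by auto
    ultimately show ?thesis
      using F(1) by (meson card_inj_on_le inj_on_finite)
  qed
  then show thesis by (rule that)
qed

lemma sph_max_attained:
  assumes "0 < \<phi>" "\<phi> \<le> pi"
  shows "\<exists>S :: (real ^ 'd) set. spherical_code \<phi> \<tau> S \<and> finite S \<and> card S = sph_max TYPE('d) \<phi> \<tau>"
    and "spherical_code \<phi> \<tau> (S :: (real ^ 'd) set) \<Longrightarrow> finite S \<and> card S \<le> sph_max TYPE('d) \<phi> \<tau>"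
proof -
  let ?A = "{card S | S :: (real ^ 'd) set. spherical_code \<phi> \<tau> S}"
  obtain N where N: "\<And>S :: (real ^ 'd) set. spherical_code \<phi> \<tau> S \<Longrightarrow> finite S \<and> card S \<le> N"
    using spherical_code_bounded[OF assms] by blast
  have fin: "finite ?A"
    by (rule finite_subset[of _ "{..N}"]) (use N in auto)
  have "spherical_code \<phi> \<tau> ({} :: (real ^ 'd) set)"
    by (simp add: spherical_code_def)
  then have "?A \<noteq> {}"
    by blast
  from Max_in[OF fin this] N
  show "\<exists>S :: (real ^ 'd) set. spherical_code \<phi> \<tau> S \<and> finite S \<and> card S = sph_max TYPE('d) \<phi> \<tau>"
    unfolding sph_max_def by force
  show "finite S \<and> card S \<le> sph_max TYPE('d) \<phi> \<tau>" if "spherical_code \<phi> \<tau> (S :: (real ^ 'd) set)"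
    using that N Max_ge[OF fin, of "card S"] unfolding sph_max_def by blast
qed


section \<open>Hyperbolic codes\<close>

type_synonym 'n lvec = "(real ^ 'n) \<times> real"

definition lform :: "'n::finite lvec \<Rightarrow> 'n lvec \<Rightarrow> real" where
  "lform q q' = - (fst q \<bullet> fst q') + snd q * snd q'"

definition hyperboloid :: "'n::finite lvec set" where
  "hyperboloid = {q. lform q q = 1 \<and> snd q > 0}"

definition ball_proj :: "'n::finite lvec \<Rightarrow> real ^ 'n" where
  "ball_proj q = fst q /\<^sub>R (1 + snd q)"

definition negative_vec :: "'n::finite lvec \<Rightarrow> bool" where
  "negative_vec w \<longleftrightarrow> lform w w < 0"

definition half_space :: "'n::finite lvec \<Rightarrow> (real ^ 'n) set" where
  "half_space w = ball_proj ` {q \<in> hyperboloid. lform w q \<le> 0}"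

definition wall :: "'n::finite lvec \<Rightarrow> (real ^ 'n) set" where
  "wall w = ball_proj ` {q \<in> hyperboloid. lform w q = 0}"

text \<open>
  The closed wall adjoins to the wall its limit points on the ideal boundary \<open>sphere 0 1\<close>. As
  the wall is relatively closed in the open unit ball, this is its Euclidean closure.
\<close>
definition closed_wall :: "'n::finite lvec \<Rightarrow> (real ^ 'n) set" where
  "closed_wall w = closure (wall w)"

definition hyp_angle :: "'n::finite lvec \<Rightarrow> 'n lvec \<Rightarrow> ereal" where
  "hyp_angle w\<^sub>1 w\<^sub>2 =
     (if closed_wall w\<^sub>1 \<inter> closed_wall w\<^sub>2 \<noteq> {}
      then ereal (arccos (- lform w\<^sub>1 w\<^sub>2 / sqrt (lform w\<^sub>1 w\<^sub>1 * lform w\<^sub>2 w\<^sub>2)))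
      else -\<infinity>)"

definition hyperbolic_code :: "'n::finite lvec set \<Rightarrow> bool" where
  "hyperbolic_code S \<longleftrightarrow> (\<forall>w\<in>S. negative_vec w)"

definition strict_hyperbolic_code :: "'n::finite lvec set \<Rightarrow> bool" where
  "strict_hyperbolic_code S \<longleftrightarrow> hyperbolic_code S \<and> (\<Union>w\<in>S. half_space w) \<noteq> ball 0 1"

text \<open>
  Inserting \<open>pi\<close> makes this the infimum within \<open>{-\<infinity>} \<union> [0, \<pi>]\<close>, so a code with at most one
  element has angle \<open>\<pi>\<close>; every other value is unaffected because angles never exceed \<open>\<pi>\<close>.
\<close>
definition code_angle :: "'n::finite lvec set \<Rightarrow> ereal" where
  "code_angle S =
     Inf (insert (ereal pi) {hyp_angle w\<^sub>1 w\<^sub>2 | w\<^sub>1 w\<^sub>2. w\<^sub>1 \<in> S \<and> w\<^sub>2 \<in> S \<and> w\<^sub>1 \<noteq> w\<^sub>2})"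

definition ecard :: "'a set \<Rightarrow> enat" where
  "ecard S = (if finite S then enat (card S) else \<infinity>)"

text \<open>With \<open>n = CARD('n)\<close>, these are $\overline{R}_n(\theta)$ and $R_n(\theta)$ respectively.\<close>

definition hyp_kissing :: "'n::finite itself \<Rightarrow> real \<Rightarrow> enat" where
  "hyp_kissing _ \<theta> =
     Sup {ecard S | S :: 'n lvec set. hyperbolic_code S \<and> code_angle S \<ge> ereal \<theta>}"

definition strict_hyp_kissing :: "'n::finite itself \<Rightarrow> real \<Rightarrow> enat" where
  "strict_hyp_kissing _ \<theta> =
     Sup {ecard S | S :: 'n lvec set. strict_hyperbolic_code S \<and> code_angle S \<ge> ereal \<theta>}"

end

theory Submission
  imports Defs
begin

text \<open>
  Rescale every vector of a code so that \<open>lform w w = -1\<close>. Two walls meet in the closed ball exactly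
  when \<open>\<bar>lform w w'\<bar> \<le> 1\<close> (\<open>closed_walls_meet_iff\<close>), so a code of angle at least \<open>\<pi>/2\<close> is the same thing
  as a set of such unit vectors with \<open>0 \<le> lform w w' \<le> 1\<close> for distinct \<open>w\<close>, \<open>w'\<close>; it is strict when some
  point \<open>q\<close> of the hyperboloid has \<open>lform w q > 0\<close> for all its vectors. All the inequalities become
  statements about such sets.

  \<^item> The factor 2: a generic \<open>q\<close> lies on no wall, and it splits the code into the vectors with
    \<open>lform w q > 0\<close> and those with \<open>lform w q < 0\<close>. The first part, and the negatives of the second, are
    strict codes (\<open>hyp_kissing_le_twice_strict\<close>).

  \<^item> Lower bounds: in the upper half-space model, hemispheres of one common Euclidean radius \<open>r\<close> whose
    centres lie at mutual distances between \<open>sqrt 2 * r\<close> and \<open>2 * r\<close> form a strict code. A spherical code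
    with angles in \<open>[\<phi>, \<tau>]\<close> provides such centres with \<open>r = sin (\<tau>/2)\<close>. For angle at least \<open>2 \<phi>\<^sub>0\<close>, with
    \<open>cos \<phi>\<^sub>0 = 3/4\<close>, the matching upper limit is \<open>\<pi> - \<phi>\<^sub>0\<close>; two points at more than this distance from a
    given point \<open>x\<close> lie within \<open>\<phi>\<^sub>0\<close> of \<open>-x\<close> and so coincide. The pairs violating the limit therefore form
    a matching, and half of the code avoids them.

  \<^item> Upper bound: move \<open>q\<close> to \<open>(0, 1)\<close>, so that \<open>lform w q\<close> is the last coordinate of \<open>w\<close>. Let \<open>w0\<close> be
    the vector for which it is largest (the analogue of the smallest of a family of balls, since this
    coordinate plays the role of curvature), and project the others to the orthogonal complement of
    \<open>w0\<close> and \<open>(0, 1)\<close>, a Euclidean space of dimension \<open>n - 1\<close>. The directions obtained, as seen from the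
    smallest ball, are at least \<open>arccos (3/4)\<close> apart (\<open>cosine_ineq\<close>); the extreme case is that of
    three balls of equal radius, two of them orthogonal to each other and tangent to the first.
\<close>

section \<open>The Lorentzian form and the ball model\<close>

lemma lform_add_left: "lform (a + b) c = lform a c + lform b c"
  and lform_diff_left: "lform (a - b) c = lform a c - lform b c"
  and lform_scaleR_left: "lform (r *\<^sub>R a) c = r * lform a c"
  and lform_minus_left: "lform (- a) c = - lform a c"
  and lform_add_right: "lform c (a + b) = lform c a + lform c b"
  and lform_diff_right: "lform c (a - b) = lform c a - lform c b"
  and lform_scaleR_right: "lform c (r *\<^sub>R a) = r * lform c a"
  and lform_minus_right: "lform c (- a) = - lform c a"
  by (simp_all add: lform_def algebra_simps)

lemmas lform_bilinear = lform_add_left lform_diff_left lform_scaleR_left lform_minus_left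
  lform_add_right lform_diff_right lform_scaleR_right lform_minus_right

lemma lform_commute: "lform a b = lform b a"
  by (simp add: lform_def inner_commute mult.commute)

lemma lform_self: "lform q q = (snd q)\<^sup>2 - (norm (fst q))\<^sup>2"
  by (simp add: lform_def power2_norm_eq_inner) (simp add: power2_eq_square)

text \<open>
  For \<open>p\<close> in the open ball this is a positive multiple of the point of the hyperboloid projecting to
  \<open>p\<close>; unlike that point it extends continuously to the ideal boundary, where it becomes a null vector.
\<close>
definition ball_lift :: "real ^ 'n::finite \<Rightarrow> 'n lvec" where
  "ball_lift p = (2 *\<^sub>R p, 1 + (norm p)\<^sup>2)"

lemma lform_ball_lift: "lform (ball_lift p) (ball_lift p) = (1 - (norm p)\<^sup>2)\<^sup>2"
  by (simp add: lform_self ball_lift_def power2_eq_square algebra_simps)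

lemma ball_lift_ball_proj:
  assumes "q \<in> hyperboloid"
  shows "ball_lift (ball_proj q) = (2 / (1 + snd q)) *\<^sub>R q"
    and "norm (ball_proj q) < 1"
proof -
  have u: "snd q > 0" and n: "(norm (fst q))\<^sup>2 = (snd q)\<^sup>2 - 1"
    using assms by (auto simp: hyperboloid_def lform_self)
  have p: "(norm (ball_proj q))\<^sup>2 = (snd q - 1) / (snd q + 1)"
  proof -
    have "(norm (ball_proj q))\<^sup>2 = ((snd q)\<^sup>2 - 1) / (1 + snd q)\<^sup>2"
      using u by (simp add: ball_proj_def power_mult_distrib n power_inverse divide_inverse)
    also have "\<dots> = (snd q - 1) / (snd q + 1)"
      using u by (simp add: power2_eq_square divide_simps) (simp add: algebra_simps)
    finally show ?thesis .
  qed
  have "1 + (norm (ball_proj q))\<^sup>2 = 2 / (1 + snd q) * snd q"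
    unfolding p using u by (simp add: divide_simps)
  moreover have "2 *\<^sub>R ball_proj q = (2 / (1 + snd q)) *\<^sub>R fst q"
    by (simp add: ball_proj_def divide_inverse)
  ultimately show "ball_lift (ball_proj q) = (2 / (1 + snd q)) *\<^sub>R q"
    by (simp add: ball_lift_def prod_eq_iff)
  have "(norm (ball_proj q))\<^sup>2 < 1\<^sup>2"
    using u by (simp add: p)
  then show "norm (ball_proj q) < 1"
    by (rule power_less_imp_less_base) simp
qed

lemma bij_betw_ball_proj:
  "bij_betw ball_proj (hyperboloid :: 'n::finite lvec set) (ball 0 1)"
proof -
  have inj: "inj_on ball_proj (hyperboloid :: 'n lvec set)"
  proof (rule inj_onI)
    fix q r :: "'n lvec" assume q: "q \<in> hyperboloid" and r: "r \<in> hyperboloid"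
      and eq: "ball_proj q = ball_proj r"
    have pos: "snd q > 0" "snd r > 0"
      using q r by (auto simp: hyperboloid_def)
    have *: "(2 / (1 + snd q)) *\<^sub>R q = (2 / (1 + snd r)) *\<^sub>R r"
      using ball_lift_ball_proj(1)[OF q] ball_lift_ball_proj(1)[OF r] eq by simp
    then have "(2 / (1 + snd q)) * snd q = (2 / (1 + snd r)) * snd r"
      by (metis snd_scaleR real_scaleR_def)
    then have "snd q = snd r"
      using pos by (simp add: field_simps)
    with * pos show "q = r" by simp
  qed
  have "p \<in> ball_proj ` hyperboloid" if "norm p < 1" for p :: "real ^ 'n"
  proof -
    define d where "d = 1 - (norm p)\<^sup>2"
    have d: "d > 0"
      using that by (simp add: d_def power_less_one_iff abs_square_less_1)
    define q where "q = (1 / d) *\<^sub>R ball_lift p"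
    have "lform q q = 1"
      using d by (simp add: q_def lform_bilinear lform_ball_lift flip: d_def)
        (simp add: power2_eq_square)
    moreover have "snd q > 0"
      using d by (simp add: q_def ball_lift_def add_pos_nonneg)
    moreover have "ball_proj q = p"
    proof -
      have "1 + snd q = 2 / d"
        using d by (simp add: q_def ball_lift_def field_simps) (simp add: d_def)
      then show ?thesis
        using d by (simp add: ball_proj_def q_def ball_lift_def)
    qed
    ultimately show ?thesis
      by (force simp: hyperboloid_def)
  qed
  with inj show ?thesis
    by (auto simp: bij_betw_def ball_lift_ball_proj(2))
qed

lemma strict_hyperbolic_code_iff:
  "strict_hyperbolic_code S \<longleftrightarrow>
     hyperbolic_code S \<and> (\<exists>q\<in>hyperboloid. \<forall>w\<in>S. 0 < lform w q)"
proof -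
  have "half_space w \<subseteq> ball 0 1" for w :: "'a lvec"
    using bij_betw_imp_surj_on[OF bij_betw_ball_proj] by (auto simp: half_space_def)
  then have "(\<Union>w\<in>S. half_space w) \<noteq> ball 0 1
      \<longleftrightarrow> (\<exists>p\<in>ball 0 1. \<forall>w\<in>S. p \<notin> half_space w)"
    by blast
  also have "\<dots> \<longleftrightarrow> (\<exists>q\<in>hyperboloid. \<forall>w\<in>S. ball_proj q \<notin> half_space w)"
    by (simp flip: bij_betw_imp_surj_on[OF bij_betw_ball_proj])
  also have "\<dots> \<longleftrightarrow> (\<exists>q\<in>hyperboloid. \<forall>w\<in>S. 0 < lform w q)"
  proof (rule bex_cong[OF refl], rule ball_cong[OF refl])
    fix q w :: "'a lvec" assume "q \<in> hyperboloid"
    then have "ball_proj q \<in> half_space w \<longleftrightarrow> lform w q \<le> 0"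
      unfolding half_space_def
      using inj_on_image_mem_iff[OF bij_betw_imp_inj_on[OF bij_betw_ball_proj],
          of q "{q \<in> hyperboloid. lform w q \<le> 0}"] by auto
    then show "ball_proj q \<notin> half_space w \<longleftrightarrow> 0 < lform w q"
      by auto
  qed
  finally show ?thesis
    by (simp add: strict_hyperbolic_code_def)
qed

section \<open>When closed walls meet\<close>

text \<open>
  The wall equation in terms of \<open>ball_lift p\<close> is polynomial in \<open>p\<close>, so it passes to the closure.
\<close>
lemma closed_wall_subset:
  "closed_wall w \<subseteq> {p. norm p \<le> 1 \<and> lform w (ball_lift p) = 0}"
  unfolding closed_wall_def
proof (rule closure_minimal)
  show "wall w \<subseteq> {p. norm p \<le> 1 \<and> lform w (ball_lift p) = 0}"
    using ball_lift_ball_proj[of q for q :: "'a lvec"]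
    by (auto simp: wall_def lform_scaleR_right less_imp_le simp del: split_paired_All scaleR_Pair)
  show "closed {p. norm p \<le> 1 \<and> lform w (ball_lift p) = 0}"
    unfolding lform_def ball_lift_def
    by (intro closed_Collect_conj closed_Collect_le closed_Collect_eq) (auto intro!: continuous_intros)
qed

text \<open>
  The scale-invariant extension of \<open>ball_proj\<close> to future timelike and null vectors: a timelike vector
  goes to the projection of its normalisation, a null vector to its ideal point.
\<close>
definition cone_proj :: "'n::finite lvec \<Rightarrow> real ^ 'n" where
  "cone_proj q = fst q /\<^sub>R (sqrt (lform q q) + snd q)"

lemma cone_proj_timelike_in_wall:
  assumes "0 < lform q q" "0 < snd q" "lform w q = 0"
  shows "cone_proj q \<in> wall w"
proof -
  define l where "l = sqrt (lform q q)"
  have l: "l > 0" "l\<^sup>2 = lform q q"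
    using assms by (auto simp: l_def)
  define q' where "q' = q /\<^sub>R l"
  have "lform q' q' = 1" "snd q' > 0" "lform w q' = 0"
    using l assms by (auto simp: q'_def lform_bilinear field_simps power2_eq_square)
  moreover have "1 + snd q / l = (l + snd q) / l"
    using l by (simp add: field_simps)
  then have "ball_proj q' = cone_proj q"
    using l by (simp add: ball_proj_def q'_def cone_proj_def divide_inverse_commute flip: l_def)
  ultimately show ?thesis
    by (force simp: wall_def hyperboloid_def)
qed

lemma timelike_orthogonal:
  assumes "negative_vec w"
  obtains q where "0 < lform q q" "lform w q = 0"
proof
  let ?e = "(0, 1) :: 'a lvec"
  let ?q = "?e - (lform w ?e / lform w w) *\<^sub>R w"
  have n: "lform w w < 0"
    using assms by (simp add: negative_vec_def)
  have "lform ?q ?q = 1 - (lform w ?e)\<^sup>2 / lform w w"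
    using n by (simp add: lform_bilinear lform_commute[of ?e w] power2_eq_square)
      (simp add: lform_def)
  also have "\<dots> > 0"
    using divide_nonneg_neg[OF zero_le_power2 n, of "lform w ?e"] by linarith
  finally show "0 < lform ?q ?q" .
  show "lform w ?q = 0"
    using n by (simp add: lform_bilinear)
qed

lemma snd_nonzero_if_causal: "0 \<le> lform q q \<Longrightarrow> q \<noteq> 0 \<Longrightarrow> snd q \<noteq> 0"
  by (auto simp: lform_self prod_eq_iff)

lemma lform_future_pos:
  assumes "0 < lform q q" "0 < snd q" "0 \<le> lform r r" "0 < snd r"
  shows "0 < lform q r"
proof -
  have "norm (fst q) < snd q"
    by (rule power_less_imp_less_base[of _ 2]) (use assms in \<open>auto simp: lform_self\<close>)
  moreover have "norm (fst r) \<le> snd r"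
    by (rule power2_le_imp_le) (use assms in \<open>auto simp: lform_self\<close>)
  ultimately have "norm (fst q) * norm (fst r) < snd q * snd r"
    using assms(4) by (intro order_le_less_trans[OF mult_left_mono mult_strict_right_mono]) simp_all
  then show ?thesis
    using norm_cauchy_schwarz[of "fst q" "fst r"] by (simp add: lform_def)
qed

text \<open>
  A null vector orthogonal to \<open>w\<close> is a limit of timelike vectors orthogonal to \<open>w\<close>: add small multiples
  of a fixed one. So its ideal point is a limit of points of the wall.
\<close>
lemma cone_proj_in_closed_wall:
  assumes w: "negative_vec w" and q: "0 \<le> lform q q" "0 < snd q" "lform w q = 0"
  shows "cone_proj q \<in> closed_wall w"
proof -
  obtain r0 where r0: "0 < lform r0 r0" "lform w r0 = 0"
    using timelike_orthogonal[OF w] .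
  have "snd r0 \<noteq> 0"
    using r0(1) zero_le_power2[of "norm (fst r0)"] unfolding lform_self by auto
  define r where "r = (if snd r0 > 0 then r0 else - r0)"
  have r: "0 < lform r r" "0 < snd r" "lform w r = 0"
    using r0 \<open>snd r0 \<noteq> 0\<close> by (auto simp: r_def lform_bilinear)
  define f where "f e = cone_proj (q + e *\<^sub>R r)" for e
  have mem: "f e \<in> wall w" if "e > 0" for e
    unfolding f_def
  proof (rule cone_proj_timelike_in_wall)
    have "0 < lform q q + 2 * e * lform r q + e\<^sup>2 * lform r r"
      using that q r lform_future_pos[OF r(1,2) q(1,2)] by (simp add: add_nonneg_pos)
    then show "0 < lform (q + e *\<^sub>R r) (q + e *\<^sub>R r)"
      by (simp add: lform_bilinear lform_commute[of q r] power2_eq_square algebra_simps)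
    show "0 < snd (q + e *\<^sub>R r)" "lform w (q + e *\<^sub>R r) = 0"
      using that q r by (auto simp: lform_bilinear add_pos_pos)
  qed
  have "sqrt (lform q q) + snd q \<noteq> 0"
    using q by (simp add: add_nonneg_pos less_imp_neq[symmetric] add_nonneg_eq_0_iff)
  then have "(f \<longlongrightarrow> f 0) (at_right 0)"
    unfolding f_def cone_proj_def lform_def
    by (intro tendsto_intros) (auto simp: lform_def intro!: tendsto_eq_intros)
  moreover have "eventually (\<lambda>e. f e \<in> closure (wall w)) (at_right 0)"
    using mem closure_subset by (fastforce simp: eventually_at_right_field intro: exI[of _ 1])
  ultimately have "f 0 \<in> closure (wall w)"
    by (intro Lim_in_closed_set[OF closed_closure]) (auto simp: trivial_limit_at_right_real)
  then show ?thesis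
    by (simp add: f_def closed_wall_def)
qed

text \<open>
  On the orthogonal complement of a timelike or null vector the form is negative semidefinite, so the
  Cauchy-Schwarz inequality holds there.
\<close>
lemma lform_Cauchy_Schwarz_orthogonal:
  assumes "0 \<le> lform q q" "q \<noteq> 0" "lform a q = 0" "lform b q = 0"
  shows "(lform a b)\<^sup>2 \<le> lform a a * lform b b"
proof -
  have neg: "lform c c \<le> 0" if "lform c q = 0" for c
  proof -
    have q: "norm (fst q) \<le> \<bar>snd q\<bar>" "snd q \<noteq> 0"
      using assms(1) snd_nonzero_if_causal[OF assms(1,2)]
        abs_le_square_iff[of "norm (fst q)" "snd q"]
      by (simp_all add: lform_self)
    have "\<bar>snd c\<bar> * \<bar>snd q\<bar> = \<bar>fst c \<bullet> fst q\<bar>"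
      using that by (simp add: lform_def flip: abs_mult)
    also have "\<dots> \<le> norm (fst c) * norm (fst q)"
      by (rule Cauchy_Schwarz_ineq2)
    also have "\<dots> \<le> norm (fst c) * \<bar>snd q\<bar>"
      using q by (simp add: mult_left_mono)
    finally have "\<bar>snd c\<bar> \<le> norm (fst c)"
      using q by simp
    then have "(snd c)\<^sup>2 \<le> (norm (fst c))\<^sup>2"
      by (metis abs_le_square_iff abs_norm_cancel)
    then show ?thesis
      by (simp add: lform_self)
  qed
  have "lform (lform b b *\<^sub>R a - lform a b *\<^sub>R b) (lform b b *\<^sub>R a - lform a b *\<^sub>R b) \<le> 0"
    using assms by (intro neg) (simp add: lform_bilinear)
  then have A: "lform b b * (lform a a * lform b b - (lform a b)\<^sup>2) \<le> 0"
    by (simp add: lform_bilinear lform_commute[of b a] power2_eq_square algebra_simps)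
  show ?thesis
  proof (cases "lform b b = 0")
    case False
    then have "lform b b < 0"
      using neg[of b] assms by simp
    with A show ?thesis
      by (simp add: mult_le_0_iff)
  next
    case True
    have B: "lform a a + 2 * s * lform a b \<le> 0" for s
    proof -
      have "lform (a + s *\<^sub>R b) (a + s *\<^sub>R b) \<le> 0"
        using assms by (intro neg) (simp add: lform_bilinear)
      then show ?thesis
        using True by (simp add: lform_bilinear lform_commute[of b a])
    qed
    have "lform a b = 0"
    proof (rule ccontr)
      assume "lform a b \<noteq> 0"
      then have "2 * ((1 - lform a a) / (2 * lform a b)) * lform a b = 1 - lform a a"
        by simp
      with B[of "(1 - lform a a) / (2 * lform a b)"] show False
        by linarith
    qed
    with True show ?thesis by simp
  qed
qed

text \<open>
  Converse of the preceding inequality. If it is strict, \<open>a\<close> and \<open>b\<close> span a definite plane and \<open>(0, 1)\<close>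
  stays timelike when projected to its complement. If equality holds, the combination of \<open>a\<close> and \<open>b\<close>
  orthogonal to both is null, or vanishes because \<open>a\<close> and \<open>b\<close> have the same wall.
\<close>
lemma causal_orthogonal_pair:
  assumes neg: "negative_vec a" "negative_vec b"
    and le: "(lform a b)\<^sup>2 \<le> lform a a * lform b b"
  obtains q where "0 \<le> lform q q" "q \<noteq> 0" "lform a q = 0" "lform b q = 0"
proof -
  have n: "lform a a < 0" "lform b b < 0"
    using neg by (auto simp: negative_vec_def)
  define g where "g = lform a a * lform b b - (lform a b)\<^sup>2"
  have [simp]: "lform b a = lform a b"
    by (rule lform_commute)
  show thesis
  proof (cases "g = 0")
    case True
    define r where "r = lform b b *\<^sub>R a - lform a b *\<^sub>R b"
    have ar: "lform a r = 0" and br: "lform b r = 0"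
      using True by (simp_all add: r_def g_def lform_bilinear power2_eq_square algebra_simps)
    show thesis
    proof (cases "r = 0")
      case False
      have "lform r r = lform b b * lform a r - lform a b * lform b r"
        by (subst r_def) (simp add: lform_bilinear)
      with ar br False show thesis
        by (intro that[of r]) auto
    next
      case True
      then have a: "a = (lform a b / lform b b) *\<^sub>R b"
        using n by (simp add: r_def eq_vector_fraction_iff)
      obtain q where q: "0 < lform q q" "lform b q = 0"
        using timelike_orthogonal[OF neg(2)] .
      show thesis
      proof (rule that[of q])
        show "lform a q = 0"
          by (subst a) (simp add: lform_bilinear q)
      qed (use q in \<open>auto simp: lform_def\<close>)
    qed
  next
    case False
    with le have g: "g > 0"
      by (simp add: g_def)
    \<comment> \<open>\<open>q\<close> is \<open>g\<close> times the projection of \<open>(0, 1)\<close> off the plane of \<open>a\<close> and \<open>b\<close>, by Cramer's rule.\<close>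
    define e :: "'a lvec" where "e = (0, 1)"
    define x where "x = lform a e"
    define y where "y = lform b e"
    have xy [simp]: "lform a e = x" "lform e a = x"
        "lform b e = y" "lform e b = y"
      by (simp_all add: x_def y_def lform_commute[of e])
    define c where "c = lform b b * x - lform a b * y"
    define d where "d = lform a a * y - lform a b * x"
    define q where "q = g *\<^sub>R e - c *\<^sub>R a - d *\<^sub>R b"
    have aq: "lform a q = 0"
      by (simp add: q_def lform_bilinear c_def d_def g_def power2_eq_square algebra_simps)
    have bq: "lform b q = 0"
      by (simp add: q_def lform_bilinear c_def d_def g_def power2_eq_square algebra_simps)
    have "lform e e = 1"
      by (simp add: e_def lform_def)
    then have eq: "lform e q = g - c * x - d * y"
      by (simp add: q_def lform_bilinear)
    have "lform q q = g * lform e q - c * lform a q - d * lform b q"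
      by (subst (1) q_def) (simp add: lform_bilinear)
    also have "\<dots> = g * (g - (c * x + d * y))"
      by (simp add: aq bq eq algebra_simps)
    finally have qq: "lform q q = g * (g - (c * x + d * y))" .
    have "lform b b * (c * x + d * y) = c\<^sup>2 + g * y\<^sup>2"
      by (simp add: c_def d_def g_def power2_eq_square algebra_simps)
    also have "\<dots> \<ge> 0"
      using g by simp
    finally have "c * x + d * y \<le> 0"
      using n by (simp add: zero_le_mult_iff)
    then have "lform q q > 0"
      using g by (simp add: qq)
    then show thesis
      using aq bq by (intro that[of q]) (auto simp: lform_def)
  qed
qed

text \<open>
  Both sides say that some timelike or null vector is orthogonal to \<open>a\<close> and \<open>b\<close>: such a vector, up to
  scaling, is a common point of the two closed walls.
\<close>
lemma closed_walls_meet_iff: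
  assumes "negative_vec a" "negative_vec b"
  shows "closed_wall a \<inter> closed_wall b \<noteq> {} \<longleftrightarrow> (lform a b)\<^sup>2 \<le> lform a a * lform b b"
proof
  assume "closed_wall a \<inter> closed_wall b \<noteq> {}"
  then obtain p where p: "lform a (ball_lift p) = 0" "lform b (ball_lift p) = 0"
    using closed_wall_subset by blast
  have "0 < 1 + (norm p)\<^sup>2"
    by (simp add: add_pos_nonneg)
  then have "ball_lift p \<noteq> 0"
    by (simp add: ball_lift_def prod_eq_iff)
  with p show "(lform a b)\<^sup>2 \<le> lform a a * lform b b"
    by (intro lform_Cauchy_Schwarz_orthogonal[of "ball_lift p"]) (auto simp: lform_ball_lift)
next
  assume "(lform a b)\<^sup>2 \<le> lform a a * lform b b"
  then obtain q where q: "0 \<le> lform q q" "q \<noteq> 0" "lform a q = 0" "lform b q = 0"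
    using causal_orthogonal_pair assms by blast
  define r where "r = (if snd q > 0 then q else - q)"
  have r: "0 \<le> lform r r" "0 < snd r" "lform a r = 0" "lform b r = 0"
    using q snd_nonzero_if_causal[of q] by (auto simp: r_def lform_bilinear)
  then show "closed_wall a \<inter> closed_wall b \<noteq> {}"
    using cone_proj_in_closed_wall assms by blast
qed


text \<open>
  The upper limit for \<open>lform a b\<close> is the condition that the walls meet, the lower one says that the
  angle is not acute.
\<close>
lemma hyp_angle_ge_right_iff:
  assumes "negative_vec a" "negative_vec b"
  shows "ereal (pi / 2) \<le> hyp_angle a b \<longleftrightarrow>
    0 \<le> lform a b \<and> lform a b \<le> sqrt (lform a a * lform b b)"
proof -
  define d where "d = sqrt (lform a a * lform b b)"
  have pos: "lform a a * lform b b > 0"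
    using assms by (simp add: negative_vec_def mult_neg_neg)
  then have d: "d > 0" "d\<^sup>2 = lform a a * lform b b"
    by (auto simp: d_def)
  have meet: "closed_wall a \<inter> closed_wall b \<noteq> {} \<longleftrightarrow> \<bar>lform a b\<bar> \<le> d"
    using d abs_le_square_iff[of "lform a b" d] by (simp add: closed_walls_meet_iff[OF assms])
  have arc: "pi / 2 \<le> arccos x \<longleftrightarrow> x \<le> 0" if "\<bar>x\<bar> \<le> 1" for x
    using arccos_le_mono[of 0 x] that unfolding arccos_0 by simp
  have "ereal (pi / 2) \<le> hyp_angle a b \<longleftrightarrow> \<bar>lform a b\<bar> \<le> d \<and> pi / 2 \<le> arccos (- lform a b / d)"
    by (simp add: hyp_angle_def meet d_def)
  also have "\<dots> \<longleftrightarrow> \<bar>lform a b\<bar> \<le> d \<and> - lform a b / d \<le> 0"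
    using d(1) by (intro conj_cong refl arc) (simp add: abs_le_iff field_simps)
  also have "\<dots> \<longleftrightarrow> 0 \<le> lform a b \<and> lform a b \<le> d"
    using d(1) by (auto simp: field_simps)
  finally show ?thesis
    by (simp add: d_def)
qed

section \<open>Codes of angle at least \<open>\<pi>/2\<close> as unit codes\<close>

definition unit_code :: "'n::finite lvec set \<Rightarrow> bool" where
  "unit_code S \<longleftrightarrow> (\<forall>w\<in>S. lform w w = -1) \<and>
     (\<forall>w\<in>S. \<forall>w'\<in>S. w \<noteq> w' \<longrightarrow> 0 \<le> lform w w' \<and> lform w w' \<le> 1)"

lemma code_angle_ge_iff:
  assumes "\<theta> \<le> pi"
  shows "ereal \<theta> \<le> code_angle S \<longleftrightarrow>
    (\<forall>w\<in>S. \<forall>w'\<in>S. w \<noteq> w' \<longrightarrow> ereal \<theta> \<le> hyp_angle w w')"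
  using assms unfolding code_angle_def le_Inf_iff by (simp del: split_paired_All split_paired_Ex) blast

lemma unit_code_hyperbolic:
  assumes "unit_code S"
  shows "hyperbolic_code S" "ereal (pi / 2) \<le> code_angle S"
proof -
  show h: "hyperbolic_code S"
    using assms by (auto simp: unit_code_def hyperbolic_code_def negative_vec_def)
  show "ereal (pi / 2) \<le> code_angle S"
    using assms h
    by (auto simp: code_angle_ge_iff hyp_angle_ge_right_iff unit_code_def hyperbolic_code_def
        simp del: split_paired_All)
qed

definition normalize_vec :: "'n::finite lvec \<Rightarrow> 'n lvec" where
  "normalize_vec w = w /\<^sub>R sqrt (- lform w w)"

text \<open>
  Normalisation is injective on the code because two positive multiples of one vector have angle 0.
\<close>
lemma unit_code_normalize:
  assumes code: "hyperbolic_code S" and angle: "ereal (pi / 2) \<le> code_angle S"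
  shows "unit_code (normalize_vec ` S)" "inj_on normalize_vec S"
proof -
  have neg: "lform w w < 0" if "w \<in> S" for w
    using code that by (auto simp: hyperbolic_code_def negative_vec_def)
  have self: "lform (normalize_vec w) (normalize_vec w) = -1" if "w \<in> S" for w
    using neg[OF that]
    by (simp add: normalize_vec_def lform_bilinear field_simps flip: power2_eq_square)
  have pair: "0 \<le> lform (normalize_vec w) (normalize_vec w') \<and>
      lform (normalize_vec w) (normalize_vec w') \<le> 1"
    if "w \<in> S" "w' \<in> S" "w \<noteq> w'" for w w'
  proof -
    have "0 \<le> lform w w'" "lform w w' \<le> sqrt (lform w w * lform w' w')"
      using angle that neg
      by (auto simp: code_angle_ge_iff hyp_angle_ge_right_iff negative_vec_def
        simp del: split_paired_All)
    moreover have "sqrt (lform w w * lform w' w') = sqrt (- lform w w) * sqrt (- lform w' w')"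
      by (simp flip: real_sqrt_mult)
    ultimately show ?thesis
      using neg[of w] neg[of w'] that
      by (simp add: normalize_vec_def lform_bilinear field_simps)
  qed
  show "inj_on normalize_vec S"
  proof (rule inj_onI, rule ccontr)
    fix w w' assume w: "w \<in> S" "w' \<in> S" "normalize_vec w = normalize_vec w'" "w \<noteq> w'"
    from pair[OF w(1,2,4)] self[OF w(1)] w(3) show False
      by simp
  qed
  with self pair show "unit_code (normalize_vec ` S)"
    unfolding unit_code_def by blast
qed

text \<open>
  This removes infinite codes from all upper bounds: subsets of codes are codes, and so a bound for the
  finite ones suffices.
\<close>
lemma ecard_le_if_finite_subsets:
  assumes "\<And>F. finite F \<Longrightarrow> F \<subseteq> S \<Longrightarrow> enat (card F) \<le> c"
  shows "ecard S \<le> c"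
proof (cases "finite S")
  case True
  then show ?thesis
    using assms by (simp add: ecard_def)
next
  case False
  have n: "enat n \<le> c" for n
  proof -
    obtain F where "F \<subseteq> S" "finite F" "card F = n"
      using infinite_arbitrarily_large[OF False] by blast
    then show ?thesis
      using assms by blast
  qed
  show ?thesis
  proof (cases c)
    case (enat m)
    with n[of "Suc m"] show ?thesis by simp
  qed simp
qed

lemma hyp_kissing_right_le:
  fixes c :: enat
  assumes bound: "\<And>S :: 'n::finite lvec set. finite S \<Longrightarrow> unit_code S \<Longrightarrow> enat (card S) \<le> c"
  shows "hyp_kissing TYPE('n) (pi / 2) \<le> c"
  unfolding hyp_kissing_def
proof (rule Sup_least, safe)
  fix S :: "'n lvec set"
  assume S: "hyperbolic_code S" "ereal (pi / 2) \<le> code_angle S"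
  show "ecard S \<le> c"
  proof (rule ecard_le_if_finite_subsets)
    fix F assume F: "finite F" "F \<subseteq> S"
    have "unit_code (normalize_vec ` F)"
      using unit_code_normalize(1)[OF S] F(2) unfolding unit_code_def by blast
    moreover have "card (normalize_vec ` F) = card F"
      using inj_on_subset[OF unit_code_normalize(2)[OF S] F(2)] by (rule card_image)
    ultimately show "enat (card F) \<le> c"
      using bound[of "normalize_vec ` F"] F(1) by simp
  qed
qed

lemma strict_hyp_kissing_right_le:
  fixes c :: enat
  assumes bound: "\<And>(S :: 'n::finite lvec set) q. finite S \<Longrightarrow> unit_code S \<Longrightarrow>
    q \<in> hyperboloid \<Longrightarrow> \<forall>w\<in>S. 0 < lform w q \<Longrightarrow> enat (card S) \<le> c"
  shows "strict_hyp_kissing TYPE('n) (pi / 2) \<le> c"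
  unfolding strict_hyp_kissing_def
proof (rule Sup_least, safe)
  fix S :: "'n lvec set"
  assume strict: "strict_hyperbolic_code S" and angle: "ereal (pi / 2) \<le> code_angle S"
  then obtain q where S: "hyperbolic_code S" and q: "q \<in> hyperboloid" "\<forall>w\<in>S. 0 < lform w q"
    unfolding strict_hyperbolic_code_iff by blast
  show "ecard S \<le> c"
  proof (rule ecard_le_if_finite_subsets)
    fix F assume F: "finite F" "F \<subseteq> S"
    have "unit_code (normalize_vec ` F)"
      using unit_code_normalize(1)[OF S angle] F(2) unfolding unit_code_def by blast
    moreover have "\<forall>w\<in>normalize_vec ` F. 0 < lform w q"
      using F(2) q(2) S
      by (auto simp: normalize_vec_def lform_bilinear hyperbolic_code_def negative_vec_def
          intro!: mult_pos_pos simp del: split_paired_All)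
    moreover have "card (normalize_vec ` F) = card F"
      using inj_on_subset[OF unit_code_normalize(2)[OF S angle] F(2)] by (rule card_image)
    ultimately show "enat (card F) \<le> c"
      using bound[of "normalize_vec ` F" q] F(1) q(1) by simp
  qed
qed

lemma card_le_strict_hyp_kissing:
  fixes S :: "'n::finite lvec set"
  assumes "finite S" "unit_code S" "q \<in> hyperboloid" "\<forall>w\<in>S. 0 < lform w q"
  shows "enat (card S) \<le> strict_hyp_kissing TYPE('n) (pi / 2)"
proof -
  have "strict_hyperbolic_code S"
    using assms unit_code_hyperbolic(1) by (auto simp: strict_hyperbolic_code_iff)
  moreover have "ereal (pi / 2) \<le> code_angle S"
    using assms(2) by (rule unit_code_hyperbolic(2))
  ultimately have "ecard S \<le> strict_hyp_kissing TYPE('n) (pi / 2)"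
    unfolding strict_hyp_kissing_def by (intro Sup_upper) auto
  with assms(1) show ?thesis
    by (simp add: ecard_def)
qed

lemma strict_hyp_kissing_le_hyp_kissing: "strict_hyp_kissing d \<theta> \<le> hyp_kissing d \<theta>"
  unfolding strict_hyp_kissing_def hyp_kissing_def strict_hyperbolic_code_def
  by (rule Sup_subset_mono) auto

section \<open>Strict and non-strict codes\<close>

text \<open>
  Finitely many hyperplanes have measure zero and cannot cover the open cone of future timelike vectors.
\<close>
lemma generic_hyperboloid_point:
  fixes S :: "'n::finite lvec set"
  assumes "finite S" "0 \<notin> S"
  obtains q where "q \<in> hyperboloid" "\<forall>w\<in>S. lform w q \<noteq> 0"
proof -
  define U where "U = {q :: 'n lvec. 0 < lform q q \<and> 0 < snd q}"
  have "open U"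
    unfolding U_def lform_def
    by (intro open_Collect_conj open_Collect_less) (auto intro!: continuous_intros)
  moreover have "(0, 1) \<in> U"
    by (simp add: U_def lform_def)
  ultimately have "\<not> negligible U"
    using open_not_negligible by blast
  moreover have "negligible (\<Union>w\<in>S. {q. lform w q = 0})"
  proof (rule negligible_Union)
    show "finite ((\<lambda>w. {q. lform w q = 0}) ` S)"
      using assms(1) by simp
    fix T assume "T \<in> (\<lambda>w. {q. lform w q = 0}) ` S"
    then obtain w where w: "w \<in> S" "T = {q. lform w q = 0}"
      by blast
    have "T = {q. (- fst w, snd w) \<bullet> q = 0}"
      by (auto simp: w(2) lform_def inner_prod_def)
    moreover have "w \<noteq> 0"
      using w(1) assms(2) by blast
    then have "(- fst w, snd w) \<noteq> 0"
      by (simp add: prod_eq_iff)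
    ultimately show "negligible T"
      using negligible_hyperplane[of "(- fst w, snd w)" 0] by simp
  qed
  ultimately obtain q where q: "0 < lform q q" "0 < snd q" "\<forall>w\<in>S. lform w q \<noteq> 0"
    using negligible_subset[of "\<Union>w\<in>S. {q. lform w q = 0}" U] unfolding U_def by blast
  define r where "r = q /\<^sub>R sqrt (lform q q)"
  have "lform r r = 1"
    using q(1) by (simp add: r_def lform_bilinear field_simps)
  moreover have "0 < snd r" "\<forall>w\<in>S. lform w r \<noteq> 0"
    using q by (auto simp: r_def lform_bilinear)
  ultimately show thesis
    by (intro that[of r]) (auto simp: hyperboloid_def)
qed

text \<open>
  Passing to the negatives of all vectors preserves the form, hence the code condition.
\<close>
lemma hyp_kissing_le_twice_strict:
  "hyp_kissing TYPE('n::finite) (pi / 2) \<le> 2 * strict_hyp_kissing TYPE('n) (pi / 2)"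
proof (rule hyp_kissing_right_le)
  fix S :: "'n lvec set" assume S: "finite S" "unit_code S"
  let ?R = "strict_hyp_kissing TYPE('n) (pi / 2)"
  have "0 \<notin> S"
    using S(2) by (auto simp: unit_code_def lform_def)
  then obtain q where q: "q \<in> hyperboloid" "\<forall>w\<in>S. lform w q \<noteq> 0"
    using generic_hyperboloid_point[OF S(1)] by metis
  define P where "P = {w\<in>S. 0 < lform w q}"
  define N where "N = {w\<in>S. lform w q < 0}"
  have "S = P \<union> N"
    using q(2) by (force simp: P_def N_def simp del: split_paired_All)
  moreover have "P \<inter> N = {}"
    by (auto simp: P_def N_def)
  moreover have fin: "finite P" "finite N"
    using S(1) by (auto simp: P_def N_def)
  ultimately have "card S = card P + card N"
    by (simp add: card_Un_disjoint)
  moreover have "enat (card P) \<le> ?R"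
  proof (rule card_le_strict_hyp_kissing)
    show "unit_code P"
      using S(2) by (auto simp: unit_code_def P_def simp del: split_paired_All)
  qed (use fin q in \<open>auto simp: P_def\<close>)
  moreover have "enat (card (uminus ` N)) \<le> ?R"
  proof (rule card_le_strict_hyp_kissing)
    show "unit_code (uminus ` N)"
      using S(2) by (auto simp: unit_code_def N_def lform_bilinear simp del: split_paired_All)
    show "\<forall>w\<in>uminus ` N. 0 < lform w q"
      by (auto simp: N_def lform_bilinear)
  qed (use fin q in auto)
  then have "enat (card N) \<le> ?R"
    by (simp add: card_image)
  ultimately show "enat (card S) \<le> 2 * ?R"
    using add_mono[of "enat (card P)" ?R "enat (card N)" ?R] by (simp add: mult_2)
qed

section \<open>Lower bounds from spherical codes\<close>

lemma hyperplane_isometries: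
  fixes a :: "real ^ 'n::finite"
  assumes "a \<noteq> 0" and card: "CARD('m::finite) = CARD('n) - 1"
  obtains f :: "real ^ 'm \<Rightarrow> real ^ 'n" and g :: "real ^ 'n \<Rightarrow> real ^ 'm"
  where "\<And>x. a \<bullet> f x = 0" "\<And>x y. f x \<bullet> f y = x \<bullet> y"
    "\<And>x y. a \<bullet> x = 0 \<Longrightarrow> a \<bullet> y = 0 \<Longrightarrow> g x \<bullet> g y = x \<bullet> y"
proof -
  have "dim (UNIV :: (real ^ 'm) set) = dim {x. a \<bullet> x = 0}"
    using assms by (simp add: dim_hyperplane)
  then obtain f :: "real ^ 'm \<Rightarrow> real ^ 'n" and g :: "real ^ 'n \<Rightarrow> real ^ 'm"
    where lin: "linear f" "linear g" and f: "f ` UNIV = {x. a \<bullet> x = 0}"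
      and "\<And>x. x \<in> UNIV \<Longrightarrow> norm (f x) = norm x"
        "\<And>x. x \<in> {x. a \<bullet> x = 0} \<Longrightarrow> norm (g x) = norm x"
    by (rule isometries_subspaces[OF subspace_UNIV subspace_hyperplane]) blast
  then have norm: "\<And>x. norm (f x) = norm x" "\<And>x. a \<bullet> x = 0 \<Longrightarrow> norm (g x) = norm x"
    by simp_all
  show thesis
  proof (rule that[of f g])
    show "a \<bullet> f x = 0" for x
      using f by blast
    show "f x \<bullet> f y = x \<bullet> y" for x y
      by (simp add: dot_norm norm(1) flip: linear_add[OF lin(1)])
    show "g x \<bullet> g y = x \<bullet> y" if "a \<bullet> x = 0" "a \<bullet> y = 0" for x y
    proof -
      have "norm (g x + g y) = norm (x + y)"
        using norm(2)[of "x + y"] that by (simp add: inner_add_right linear_add[OF lin(2)])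
      then show ?thesis
        using that by (simp add: dot_norm norm(2))
    qed
  qed
qed

text \<open>
  In the upper half-space model over \<open>real ^ 'm\<close>, the hemisphere with centre \<open>x\<close> and radius \<open>r\<close> is the
  wall of the unit vector \<open>(x, (1 - s) / 2; (1 + s) / 2) / r\<close> with \<open>s = (norm x)\<^sup>2 - r\<^sup>2\<close>, and two of these have
  Lorentzian product \<open>(D\<^sup>2 - 2 * r\<^sup>2) / (2 * r\<^sup>2)\<close>, where \<open>D\<close> is the distance of the centres. The
  hypothesis says \<open>2 * r\<^sup>2 \<le> D\<^sup>2 \<le> 4 * r\<^sup>2\<close>.
\<close>
lemma card_le_strict_hyp_kissing_of_spherical:
  fixes X :: "(real ^ 'm::finite) set"
  assumes card: "CARD('m) = CARD('n::finite) - 1"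
    and X: "finite X" "X \<subseteq> sphere 0 1" and r: "0 < r" "r \<le> 1"
    and ip: "\<And>x y. x \<in> X \<Longrightarrow> y \<in> X \<Longrightarrow> x \<noteq> y \<Longrightarrow> 1 - 2 * r\<^sup>2 \<le> x \<bullet> y \<and> x \<bullet> y \<le> 1 - r\<^sup>2"
  shows "enat (card X) \<le> strict_hyp_kissing TYPE('n) (pi / 2)"
proof -
  obtain a :: "real ^ 'n" where a: "norm a = 1"
    using vector_choose_size[of 1] by auto
  then have "a \<noteq> 0" by auto
  then obtain f :: "real ^ 'm \<Rightarrow> real ^ 'n"
    where f: "\<And>x. a \<bullet> f x = 0" "\<And>x y. f x \<bullet> f y = x \<bullet> y"
    using hyperplane_isometries[OF _ card] by metis
  define W where "W x = ((1 / r) *\<^sub>R (f x + (r\<^sup>2 / 2) *\<^sub>R a), (2 - r\<^sup>2) / (2 * r))" for x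
  have W: "lform (W x) (W y) = (1 - r\<^sup>2 - x \<bullet> y) / r\<^sup>2" for x y
  proof -
    have "a \<bullet> a = 1" "f x \<bullet> a = 0"
      using a f(1)[of x] by (auto simp: norm_eq_1 inner_commute)
    then have "lform (W x) (W y) = - (x \<bullet> y + r\<^sup>2 / 2 * (r\<^sup>2 / 2)) / r\<^sup>2
        + ((2 - r\<^sup>2) / (2 * r)) * ((2 - r\<^sup>2) / (2 * r))"
      using r by (simp add: lform_def W_def inner_add_left inner_add_right f power2_eq_square divide_simps)
    also have "\<dots> = (1 - r\<^sup>2 - x \<bullet> y) / r\<^sup>2"
      using r by (simp add: field_simps power2_eq_square)
    finally show ?thesis .
  qed
  have unit: "x \<bullet> x = 1" if "x \<in> X" for x
    using X(2) that by (auto simp: norm_eq_1)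
  have self: "lform (W x) (W x) = -1" if "x \<in> X" for x
    using r by (simp add: W unit[OF that])
  have pair: "0 \<le> lform (W x) (W y) \<and> lform (W x) (W y) \<le> 1" if "x \<in> X" "y \<in> X" "x \<noteq> y" for x y
    using ip[OF that] r by (simp add: W field_simps)
  have "inj_on W X"
  proof (rule inj_onI, rule ccontr)
    fix x y assume "x \<in> X" "y \<in> X" "W x = W y" "x \<noteq> y"
    with pair[of x y] self[of x] show False by simp
  qed
  moreover have "enat (card (W ` X)) \<le> strict_hyp_kissing TYPE('n) (pi / 2)"
  proof (rule card_le_strict_hyp_kissing)
    show "unit_code (W ` X)"
      using self pair unfolding unit_code_def by blast
    show "(0, 1) \<in> hyperboloid"
      by (simp add: hyperboloid_def lform_def)
    have "r\<^sup>2 \<le> 1"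
      using r by (simp add: power_le_one)
    then show "\<forall>w\<in>W ` X. 0 < lform w (0, 1)"
      using r by (auto simp: W_def lform_def)
  qed (use X in auto)
  ultimately show ?thesis
    by (simp add: card_image)
qed

lemma spherical_code_inner_bounds:
  assumes "spherical_code \<phi> \<tau> S" "0 \<le> \<phi>" "\<phi> \<le> pi" "\<tau> \<le> pi" "x \<in> S" "y \<in> S" "x \<noteq> y"
  shows "cos \<tau> \<le> x \<bullet> y \<and> x \<bullet> y \<le> cos \<phi>"
proof -
  have n: "norm x = 1" "norm y = 1" and a: "\<phi> \<le> arccos (x \<bullet> y)" "arccos (x \<bullet> y) \<le> \<tau>"
    using assms by (auto simp: spherical_code_def sph_angle_def)
  have "\<bar>x \<bullet> y\<bar> \<le> 1"
    using Cauchy_Schwarz_ineq2[of x y] n by simp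
  then have b: "-1 \<le> x \<bullet> y" "x \<bullet> y \<le> 1"
    by linarith+
  have "cos (arccos (x \<bullet> y)) \<le> cos \<phi>"
    using a assms(2) arccos_ubound[OF b] by (intro cos_monotone_0_pi_le)
  moreover have "cos \<tau> \<le> cos (arccos (x \<bullet> y))"
    using a assms(4) arccos_lbound[OF b] by (intro cos_monotone_0_pi_le)
  ultimately show ?thesis
    using b by simp
qed

text \<open>
  With \<open>r = sin (\<tau> / 2)\<close> the half-angle formulas give \<open>cos \<tau> = 1 - 2 * r\<^sup>2\<close> and, by the relation between
  the two angles, \<open>cos \<phi> = 1 - r\<^sup>2\<close>.
\<close>
lemma sph_max_le_strict_hyp_kissing:
  assumes card: "CARD('m::finite) = CARD('n::finite) - 1"
    and "0 < \<phi>" "\<phi> < \<tau>" "\<tau> \<le> pi" and eq: "sqrt 2 * sin (\<phi> / 2) = sin (\<tau> / 2)"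
  shows "enat (sph_max TYPE('m) \<phi> \<tau>) \<le> strict_hyp_kissing TYPE('n) (pi / 2)"
proof -
  obtain S :: "(real ^ 'm) set"
    where S: "spherical_code \<phi> \<tau> S" "finite S" "card S = sph_max TYPE('m) \<phi> \<tau>"
    using sph_max_attained(1)[of \<phi> \<tau>] assms by auto
  define r where "r = sin (\<tau> / 2)"
  have "r > 0"
    unfolding r_def using assms by (intro sin_gt_zero) auto
  have "cos \<tau> = 1 - 2 * r\<^sup>2"
    using cos_double_sin[of "\<tau> / 2"] by (simp add: r_def)
  moreover have "cos \<phi> = 1 - r\<^sup>2"
    using cos_double_sin[of "\<phi> / 2"] by (simp add: r_def power_mult_distrib flip: eq)
  ultimately have "1 - 2 * r\<^sup>2 \<le> x \<bullet> y \<and> x \<bullet> y \<le> 1 - r\<^sup>2" if "x \<in> S" "y \<in> S" "x \<noteq> y" for x y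
    using spherical_code_inner_bounds[OF S(1)] that assms by simp
  then have "enat (card S) \<le> strict_hyp_kissing TYPE('n) (pi / 2)"
    using \<open>r > 0\<close> S by (intro card_le_strict_hyp_kissing_of_spherical[OF card, where r = r])
      (auto simp: r_def spherical_code_def)
  with S(3) show ?thesis by simp
qed

text \<open>
  Take \<open>T\<close> maximal without related pairs. Every element outside \<open>T\<close> then has a partner in \<open>T\<close>, and
  distinct elements have distinct partners.
\<close>
lemma independent_half_of_matching:
  assumes "finite S" and sym: "\<And>x y. B x y \<Longrightarrow> B y x"
    and matching: "\<And>x y z. x \<in> S \<Longrightarrow> y \<in> S \<Longrightarrow> z \<in> S \<Longrightarrow> B x y \<Longrightarrow> B x z \<Longrightarrow> y = z"
  obtains T where "T \<subseteq> S" "\<And>x y. x \<in> T \<Longrightarrow> y \<in> T \<Longrightarrow> x \<noteq> y \<Longrightarrow> \<not> B x y"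
    "card S \<le> 2 * card T"
proof -
  define I where "I = {T. T \<subseteq> S \<and> (\<forall>x\<in>T. \<forall>y\<in>T. x \<noteq> y \<longrightarrow> \<not> B x y)}"
  have "finite I" "I \<noteq> {}"
    using assms(1) by (auto simp: I_def)
  then obtain T where T: "T \<in> I" "\<And>T'. T' \<in> I \<Longrightarrow> T \<subseteq> T' \<Longrightarrow> T = T'"
    using finite_has_maximal[of I] by blast
  have "\<exists>y\<in>T. B x y" if "x \<in> S - T" for x
  proof (rule ccontr)
    assume "\<not> (\<exists>y\<in>T. B x y)"
    then have "insert x T \<in> I"
      using T(1) that sym unfolding I_def by blast
    with T(2)[of "insert x T"] that show False by blast
  qed
  then obtain p where p: "\<And>x. x \<in> S - T \<Longrightarrow> p x \<in> T \<and> B x (p x)"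
    by metis
  have TS: "T \<subseteq> S"
    using T(1) by (simp add: I_def)
  have "inj_on p (S - T)"
  proof (rule inj_onI)
    fix x y assume "x \<in> S - T" "y \<in> S - T" "p x = p y"
    then show "x = y"
      using p[of x] p[of y] TS sym matching[of "p x" x y] by auto
  qed
  then have "card (S - T) \<le> card T"
    using p finite_subset[OF TS assms(1)] by (intro card_inj_on_le[of p]) auto
  then have "card S \<le> 2 * card T"
    using card_Diff_subset[OF finite_subset[OF TS assms(1)] TS] by linarith
  with TS T(1) show thesis
    by (intro that[of T]) (auto simp: I_def)
qed

text \<open>
  Here \<open>cos (2 \<phi>\<^sub>0) = 1/8\<close>, which forces \<open>r\<^sup>2 = 7/8\<close> and asks for inner products at least \<open>-3/4\<close>. A point
  \<open>x\<close> violates this with at most one other point of the code, so half of the code is free of violations.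
\<close>
lemma half_sph_max_le_strict_hyp_kissing:
  assumes card: "CARD('m::finite) = CARD('n::finite) - 1"
  shows "enat (sph_max_ge TYPE('m) (2 * arccos (3 / 4)) div 2) \<le> strict_hyp_kissing TYPE('n) (pi / 2)"
proof -
  let ?\<phi> = "2 * arccos (3 / 4) :: real"
  have "0 < ?\<phi>" "?\<phi> \<le> pi"
    using arccos_less_arccos[of "3 / 4" 1] arccos_le_mono[of "3 / 4" 0] unfolding arccos_0 arccos_1 by auto
  then obtain S :: "(real ^ 'm) set"
    where S: "spherical_code ?\<phi> pi S" "finite S" "card S = sph_max_ge TYPE('m) ?\<phi>"
    using sph_max_attained(1)[of ?\<phi> pi] by auto
  have "cos ?\<phi> = 1 / 8"
    by (subst cos_double_cos) (simp add: power2_eq_square)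
  moreover have "x \<bullet> y \<le> cos ?\<phi>" if "x \<in> S" "y \<in> S" "x \<noteq> y" for x y
    using spherical_code_inner_bounds[OF S(1)] that \<open>0 < ?\<phi>\<close> \<open>?\<phi> \<le> pi\<close> by simp
  ultimately have ip: "x \<bullet> y \<le> 1 / 8" if "x \<in> S" "y \<in> S" "x \<noteq> y" for x y
    using that by metis
  have sph: "norm x = 1" if "x \<in> S" for x
    using S(1) that by (auto simp: spherical_code_def)
  obtain T where T: "T \<subseteq> S" "\<And>x y. x \<in> T \<Longrightarrow> y \<in> T \<Longrightarrow> x \<noteq> y \<Longrightarrow> \<not> x \<bullet> y < - 3 / 4"
    "card S \<le> 2 * card T"
  proof (rule independent_half_of_matching[OF S(2), where B = "\<lambda>x y. x \<bullet> y < - 3 / 4"])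
    fix x y z assume xyz: "x \<in> S" "y \<in> S" "z \<in> S" "x \<bullet> y < - 3 / 4" "x \<bullet> z < - 3 / 4"
    \<comment> \<open>If \<open>y \<bullet> z \<le> 1/8\<close>, then \<open>y + z\<close> has norm at most \<open>3/2\<close>, too short for both inner products.\<close>
    show "y = z"
    proof (rule ccontr)
      assume "y \<noteq> z"
      have "(norm (y + z))\<^sup>2 = 2 + 2 * (y \<bullet> z)"
        using sph[OF xyz(2)] sph[OF xyz(3)] by (simp add: power2_norm_eq_inner inner_add_left inner_add_right inner_commute norm_eq_1)
      also have "\<dots> \<le> (3 / 2)\<^sup>2"
        using ip[OF xyz(2,3) \<open>y \<noteq> z\<close>] by (simp add: power2_eq_square)
      finally have "norm (y + z) \<le> 3 / 2"
        by (rule power2_le_imp_le) simp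
      moreover have "\<bar>x \<bullet> (y + z)\<bar> \<le> norm (y + z)"
        using Cauchy_Schwarz_ineq2[of x "y + z"] sph[OF xyz(1)] by simp
      ultimately show False
        using xyz by (simp add: inner_add_right)
    qed
  qed (auto simp: inner_commute)
  define r :: real where "r = sqrt (7 / 8)"
  have r2: "r\<^sup>2 = 7 / 8"
    by (simp add: r_def)
  have "enat (card T) \<le> strict_hyp_kissing TYPE('n) (pi / 2)"
  proof (rule card_le_strict_hyp_kissing_of_spherical[OF card, where r = r])
    show "0 < r" "r \<le> 1"
      by (auto simp: r_def)
    show "1 - 2 * r\<^sup>2 \<le> x \<bullet> y \<and> x \<bullet> y \<le> 1 - r\<^sup>2" if "x \<in> T" "y \<in> T" "x \<noteq> y" for x y
      using T(2)[OF that] ip[of x y] that T(1) by (auto simp: r2)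
    show "finite T"
      using T(1) S(2) by (rule finite_subset)
    show "T \<subseteq> sphere 0 1"
      using T(1) sph by auto
  qed
  moreover have "card S div 2 \<le> card T"
    using T(3) by linarith
  ultimately show ?thesis
    by (metis S(3) enat_ord_simps(1) order_trans)
qed

section \<open>The upper bound\<close>

text \<open>
  The isometry is the reflection that exchanges \<open>q\<close> and \<open>(0, 1)\<close>.
\<close>
lemma hyperboloid_to_apex:
  fixes q :: "'n::finite lvec"
  assumes q: "q \<in> hyperboloid"
  obtains R :: "'n lvec \<Rightarrow> 'n lvec"
  where "\<And>x y. lform (R x) (R y) = lform x y" "\<And>x. snd (R x) = lform x q"
proof -
  have qq: "lform q q = 1" and u: "snd q > 0"
    using q by (auto simp: hyperboloid_def)
  show thesis
  proof (cases "snd q = 1")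
    case True
    then have "q = (0, 1)"
      using qq by (simp add: prod_eq_iff lform_self)
    then show thesis
      by (intro that[of "\<lambda>x. x"]) (auto simp: lform_def)
  next
    case False
    define d where "d = q - (0, 1)"
    define R where "R x = x - (2 * (lform x d / lform d d)) *\<^sub>R d" for x
    have xd: "lform x d = lform x q - snd x" for x
      by (simp add: d_def lform_bilinear) (simp add: lform_def)
    have dd: "lform d d = 2 - 2 * snd q"
      by (simp add: xd) (simp add: d_def lform_bilinear qq, simp add: lform_def)
    have "lform (R x) (R y) = lform x y" for x y
      using False dd by (simp add: R_def lform_bilinear lform_commute[of d y])
    moreover have "snd (R x) = lform x q" for x
    proof -
      have "snd (R x) = snd x - 2 * (lform x d / lform d d) * (snd q - 1)"
        by (simp add: R_def d_def)
      also have "\<dots> = snd x + lform x d"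
        using False by (simp add: dd field_simps)
      finally show ?thesis by (simp add: xd)
    qed
    ultimately show thesis by (rule that)
  qed
qed

text \<open>
  The quotient \<open>(k * l - s * t) / sqrt (\<dots>)\<close> is a cosine that increases with \<open>k\<close> and with \<open>l\<close> as long as
  it is nonnegative, so the worst case is \<open>k = 1 + s\<close>, \<open>l = 1 + t\<close>. There the claim is
  \<open>4 * (1 + s + t)\<^sup>2 \<le> 9 * (1 + s) * (1 + t)\<close>, with equality only for \<open>s = t = 1\<close>.
\<close>
lemma cosine_ineq:
  fixes s t k l :: real
  assumes s: "0 \<le> s" "s \<le> 1" and t: "0 \<le> t" "t \<le> 1"
    and k: "0 \<le> k" "k \<le> 1 + s" and l: "0 \<le> l" "l \<le> 1 + t"
  shows "4 * (k * l - s * t) \<le> 3 * sqrt ((1 - s\<^sup>2 + k\<^sup>2) * (1 - t\<^sup>2 + l\<^sup>2))"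
proof (cases "k * l \<le> s * t")
  case True
  have "0 \<le> (1 - s\<^sup>2 + k\<^sup>2) * (1 - t\<^sup>2 + l\<^sup>2)"
    using s t by (intro mult_nonneg_nonneg add_nonneg_nonneg) (auto simp: power_le_one)
  then have "0 \<le> 3 * sqrt ((1 - s\<^sup>2 + k\<^sup>2) * (1 - t\<^sup>2 + l\<^sup>2))"
    by simp
  moreover have "4 * (k * l - s * t) \<le> 0"
    using True by simp
  ultimately show ?thesis by (rule order_trans[rotated])
next
  case False
  \<comment> \<open>Monotonicity of the squared cosine in one variable, with denominators cleared.\<close>
  have mono: "(k * l - c)\<^sup>2 * (a + K\<^sup>2) \<le> (K * l - c)\<^sup>2 * (a + k\<^sup>2)"
    if "0 \<le> a" "0 \<le> c" "c \<le> k * l" "0 \<le> k" "k \<le> K" "0 \<le> l" for a c k l K :: real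
  proof -
    have kK: "k * l \<le> K * l"
      using that by (simp add: mult_right_mono)
    have "(k * l - c)\<^sup>2 \<le> (K * l - c)\<^sup>2"
      using that kK by (intro power_mono) auto
    moreover have "(K * (k * l - c))\<^sup>2 \<le> (k * (K * l - c))\<^sup>2"
    proof (rule power_mono)
      show "K * (k * l - c) \<le> k * (K * l - c)"
        using that mult_right_mono[of k K c] by (simp add: algebra_simps)
      show "0 \<le> K * (k * l - c)"
        using that by (intro mult_nonneg_nonneg) auto
    qed
    ultimately show ?thesis
      using mult_left_mono[of "(k * l - c)\<^sup>2" "(K * l - c)\<^sup>2" a] that(1)
      unfolding power_mult_distrib distrib_left by (simp add: mult.commute)
  qed
  let ?K = "1 + s" and ?L = "1 + t"
  let ?P = "1 - s\<^sup>2 + k\<^sup>2" and ?Q = "1 - t\<^sup>2 + l\<^sup>2"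
  have K2: "1 - s\<^sup>2 + ?K\<^sup>2 = 2 * ?K" and L2: "1 - t\<^sup>2 + ?L\<^sup>2 = 2 * ?L"
    by (simp_all add: power2_eq_square algebra_simps)
  have nn: "0 \<le> 1 - s\<^sup>2" "0 \<le> 1 - t\<^sup>2" "0 \<le> s * t"
    using s t by (simp_all add: power_le_one)
  have P: "0 \<le> ?P" and Q: "0 \<le> ?Q"
    using nn by simp_all
  have 1: "(k * l - s * t)\<^sup>2 * (2 * ?K) \<le> (?K * l - s * t)\<^sup>2 * ?P"
    using mono[OF nn(1,3) _ k l(1)] False by (simp add: K2)
  have "s * t \<le> l * ?K"
    using False mult_right_mono[OF k(2) l(1)] by (simp add: mult.commute)
  then have 2: "(?K * l - s * t)\<^sup>2 * (2 * ?L) \<le> (?K * ?L - s * t)\<^sup>2 * ?Q"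
    using mono[OF nn(2,3) _ l, of ?K] s by (simp add: L2 mult.commute)
  have 3: "16 * (?K * ?L - s * t)\<^sup>2 \<le> 9 * ((2 * ?K) * (2 * ?L))"
  proof -
    have "0 \<le> (1 - s) * (1 - t)" "s\<^sup>2 \<le> s" "t\<^sup>2 \<le> t"
      using s t by (simp_all add: power2_eq_square mult_left_le)
    then show ?thesis
      using s t by (simp add: power2_eq_square algebra_simps)
  qed
  have "16 * (k * l - s * t)\<^sup>2 * ((2 * ?K) * (2 * ?L))
      = 16 * (2 * ?L) * ((k * l - s * t)\<^sup>2 * (2 * ?K))"
    by (simp only: mult_ac)
  also have "\<dots> \<le> 16 * (2 * ?L) * ((?K * l - s * t)\<^sup>2 * ?P)"
    using 1 t by (intro mult_left_mono) auto
  also have "\<dots> = 16 * ?P * ((?K * l - s * t)\<^sup>2 * (2 * ?L))"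
    by (simp only: mult_ac)
  also have "\<dots> \<le> 16 * ?P * ((?K * ?L - s * t)\<^sup>2 * ?Q)"
    using 2 P by (intro mult_left_mono) auto
  also have "\<dots> = (16 * (?K * ?L - s * t)\<^sup>2) * (?P * ?Q)"
    by (simp only: mult_ac)
  also have "\<dots> \<le> (9 * ((2 * ?K) * (2 * ?L))) * (?P * ?Q)"
    using 3 P Q by (intro mult_right_mono) auto
  also have "\<dots> = 9 * (?P * ?Q) * ((2 * ?K) * (2 * ?L))"
    by (simp only: mult_ac)
  finally have "16 * (k * l - s * t)\<^sup>2 \<le> 9 * (?P * ?Q)"
    using s t by (subst (asm) mult_le_cancel_right_pos) auto
  then have "(4 * (k * l - s * t))\<^sup>2 \<le> (3 * sqrt (?P * ?Q))\<^sup>2"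
    using P Q unfolding power_mult_distrib by simp
  then show ?thesis
    by (rule power2_le_imp_le) (use P Q in simp)
qed

text \<open>
  The vector \<open>w0\<close> with the largest last coordinate \<open>u\<close> is set aside. For the others put \<open>t = lform w w0\<close>, and
  let \<open>k\<close> be the component of \<open>w\<close> along the unit timelike vector of the plane spanned by \<open>w0\<close> and
  \<open>(0, 1)\<close> that is orthogonal to \<open>w0\<close>, up to sign. The projections \<open>Y w\<close> to the complement of this plane
  then have inner products \<open>k w * k w' - t w * t w' - lform w w'\<close>, where the last term only helps, and
  maximality of \<open>u\<close> gives \<open>k w \<le> 1 + t w\<close>. The remaining estimate is \<open>cosine_ineq\<close>.
\<close>
lemma card_unit_code_le:
  fixes S :: "'n::finite lvec set"
  assumes card: "CARD('m::finite) = CARD('n) - 1"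
    and S: "finite S" "unit_code S" and pos: "\<And>w. w \<in> S \<Longrightarrow> 0 < snd w"
  shows "card S \<le> sph_max_ge TYPE('m) (arccos (3 / 4)) + 1"
proof (cases "S = {}")
  case False
  then have "Max (snd ` S) \<in> snd ` S"
    using S(1) by (intro Max_in) auto
  then obtain w0 where "w0 \<in> S" "Max (snd ` S) = snd w0"
    by blast
  then have w0: "w0 \<in> S" "\<And>w. w \<in> S \<Longrightarrow> snd w \<le> snd w0"
    using Max_ge[of "snd ` S"] S(1) by (auto simp del: split_paired_All)
  define v where "v = fst w0"
  define u where "u = snd w0"
  have u: "u > 0"
    using pos w0 by (simp add: u_def)
  have unit: "lform w w = -1" if "w \<in> S" for w
    using S(2) that by (simp add: unit_code_def)
  have pair: "0 \<le> lform w w'" "lform w w' \<le> 1" if "w \<in> S" "w' \<in> S" "w \<noteq> w'" for w w'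
    using S(2) that unfolding unit_code_def by blast+
  have vv: "v \<bullet> v = 1 + u\<^sup>2"
    using unit[OF w0(1)] by (simp add: lform_def v_def u_def power2_eq_square)
  define c where "c = sqrt (1 + u\<^sup>2)"
  have c: "c\<^sup>2 = 1 + u\<^sup>2" "0 < c" "u \<le> c"
    using u by (auto simp: c_def add_pos_nonneg real_le_rsqrt)
  have vc: "v \<bullet> v = c\<^sup>2"
    by (simp add: vv c(1))
  have "v \<noteq> 0"
    using vv by (metis add_pos_nonneg inner_zero_left less_irrefl zero_le_power2 zero_less_one)
  then obtain g :: "real ^ 'n \<Rightarrow> real ^ 'm"
    where g: "\<And>x y. v \<bullet> x = 0 \<Longrightarrow> v \<bullet> y = 0 \<Longrightarrow> g x \<bullet> g y = x \<bullet> y"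
    using hyperplane_isometries[OF _ card] by metis
  define t where "t w = lform w w0" for w
  define k where "k w = (snd w + t w * u) / c" for w
  define X where "X w = fst w - ((fst w \<bullet> v) / c\<^sup>2) *\<^sub>R v" for w :: "'n lvec"
  define Y where "Y w = g (X w)" for w
  have YY: "Y w \<bullet> Y w' = k w * k w' - t w * t w' - lform w w'" for w w' :: "'n lvec"
  proof -
    have "v \<bullet> X w = 0" for w :: "'n lvec"
      using c(2) by (simp add: X_def inner_diff_right vc inner_commute)
    then have "Y w \<bullet> Y w' = X w \<bullet> X w'"
      by (simp add: Y_def g)
    also have "\<dots> = fst w \<bullet> fst w' - (fst w \<bullet> v) * (fst w' \<bullet> v) / c\<^sup>2"
      using c(2) by (simp add: X_def inner_diff_right inner_diff_left vc inner_commute[of v "fst w'"])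
    also have "fst w \<bullet> fst w' = snd w * snd w' - lform w w'"
      by (simp add: lform_def)
    also have "fst w \<bullet> v = snd w * u - t w"
      by (simp add: t_def lform_def v_def u_def)
    also have "fst w' \<bullet> v = snd w' * u - t w'"
      by (simp add: t_def lform_def v_def u_def)
    also have "snd w * snd w' - lform w w' - (snd w * u - t w) * (snd w' * u - t w') / c\<^sup>2
        = (snd w + t w * u) * (snd w' + t w' * u) / c\<^sup>2 - t w * t w' - lform w w'"
      unfolding c(1) using add_pos_nonneg[of 1 "u\<^sup>2"] by (simp add: divide_simps) (simp add: power2_eq_square algebra_simps)
    finally show ?thesis
      by (simp add: k_def power2_eq_square)
  qed
  have range: "0 \<le> t w" "t w \<le> 1" "0 < k w" "k w \<le> 1 + t w" if "w \<in> S - {w0}" for w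
  proof -
    show t: "0 \<le> t w" "t w \<le> 1"
      using pair[of w w0] that w0(1) by (auto simp: t_def simp del: split_paired_All)
    show "0 < k w"
      using t u c pos[of w] that by (simp add: k_def add_pos_nonneg)
    have "snd w + t w * u \<le> c + t w * c"
      using w0(2)[of w] that c(3) t by (intro add_mono mult_left_mono) (auto simp: u_def simp del: split_paired_All)
    then show "k w \<le> 1 + t w"
      using c by (simp add: k_def field_simps)
  qed
  have normY: "(norm (Y w))\<^sup>2 = 1 - (t w)\<^sup>2 + (k w)\<^sup>2" "0 < norm (Y w)" if "w \<in> S - {w0}" for w
  proof -
    show eq: "(norm (Y w))\<^sup>2 = 1 - (t w)\<^sup>2 + (k w)\<^sup>2"
      using unit[of w] that by (simp add: power2_norm_eq_inner YY) (simp add: power2_eq_square)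
    have "(t w)\<^sup>2 \<le> 1" "0 < (k w)\<^sup>2"
      using range[OF that] by (auto simp: power_le_one)
    with eq have "0 < (norm (Y w))\<^sup>2"
      by linarith
    then show "0 < norm (Y w)"
      by (simp add: zero_less_power2)
  qed
  define Z where "Z w = Y w /\<^sub>R norm (Y w)" for w
  have ZZ: "Z w \<bullet> Z w' \<le> 3 / 4" if w: "w \<in> S - {w0}" "w' \<in> S - {w0}" "w \<noteq> w'" for w w'
  proof -
    have "4 * (Y w \<bullet> Y w') \<le> 4 * (k w * k w' - t w * t w')"
      using pair(1)[of w w'] w by (simp add: YY)
    also have "\<dots> \<le> 3 * sqrt ((1 - (t w)\<^sup>2 + (k w)\<^sup>2) * (1 - (t w')\<^sup>2 + (k w')\<^sup>2))"
      using range[OF w(1)] range[OF w(2)] by (intro cosine_ineq) auto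
    also have "\<dots> = 3 * (norm (Y w) * norm (Y w'))"
      by (simp add: real_sqrt_mult flip: normY(1)[OF w(1)] normY(1)[OF w(2)])
    finally show ?thesis
      using normY(2)[OF w(1)] normY(2)[OF w(2)] by (simp add: Z_def field_simps)
  qed
  have normZ: "norm (Z w) = 1" if "w \<in> S - {w0}" for w
    using normY(2)[OF that] by (simp add: Z_def)
  have inj: "inj_on Z (S - {w0})"
  proof (rule inj_onI, rule ccontr)
    fix w w' assume w: "w \<in> S - {w0}" "w' \<in> S - {w0}" "Z w = Z w'" "w \<noteq> w'"
    have "Z w \<bullet> Z w' = 1"
      using normZ[OF w(1)] w(3) by (simp add: norm_eq_1)
    with ZZ[OF w(1,2,4)] show False by simp
  qed
  have "spherical_code (arccos (3 / 4)) pi (Z ` (S - {w0}))"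
    unfolding spherical_code_def sph_angle_def
  proof (intro conjI ballI impI)
    show "Z ` (S - {w0}) \<subseteq> sphere 0 1"
      using normZ by (intro image_subsetI) simp
    fix x y assume xy: "x \<in> Z ` (S - {w0})" "y \<in> Z ` (S - {w0})" "x \<noteq> y"
    then have "norm x = 1" "norm y = 1"
      using normZ by blast+
    then have "\<bar>x \<bullet> y\<bar> \<le> 1"
      using Cauchy_Schwarz_ineq2[of x y] by simp
    then have b: "-1 \<le> x \<bullet> y" "x \<bullet> y \<le> 1"
      by linarith+
    then show "arccos (x \<bullet> y) \<le> pi"
      by (rule arccos_ubound)
    have "x \<bullet> y \<le> 3 / 4"
      using xy ZZ by blast
    with b show "arccos (3 / 4) \<le> arccos (x \<bullet> y)"
      by (intro arccos_le_arccos) auto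
  qed
  moreover have "0 < arccos (3 / 4 :: real)" "arccos (3 / 4 :: real) \<le> pi"
    using arccos_less_arccos[of "3 / 4" 1] arccos_ubound[of "3 / 4"] unfolding arccos_1 by auto
  ultimately have "card (Z ` (S - {w0})) \<le> sph_max_ge TYPE('m) (arccos (3 / 4))"
    using sph_max_attained(2) by blast
  then show ?thesis
    using card_image[OF inj] w0(1) S(1) by (simp add: card_Diff_singleton)
qed simp

lemma strict_hyp_kissing_le_sph_max:
  assumes card: "CARD('m::finite) = CARD('n::finite) - 1"
  shows "strict_hyp_kissing TYPE('n) (pi / 2) \<le> enat (sph_max_ge TYPE('m) (arccos (3 / 4)) + 1)"
proof (rule strict_hyp_kissing_right_le)
  fix S :: "'n lvec set" and q
  assume S: "finite S" "unit_code S" and q: "q \<in> hyperboloid" "\<forall>w\<in>S. 0 < lform w q"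
  obtain R :: "'n lvec \<Rightarrow> 'n lvec"
    where R: "\<And>x y. lform (R x) (R y) = lform x y" "\<And>x. snd (R x) = lform x q"
    using hyperboloid_to_apex[OF q(1)] by metis
  have "inj_on R S"
  proof (rule inj_onI, rule ccontr)
    fix w w' assume w: "w \<in> S" "w' \<in> S" "R w = R w'" "w \<noteq> w'"
    then have "0 \<le> lform w w'" "lform w w = -1"
      using S(2) unfolding unit_code_def by blast+
    moreover have "lform w w' = lform w w"
      using w(3) by (metis R(1))
    ultimately show False by simp
  qed
  then have "card (R ` S) = card S"
    by (rule card_image)
  moreover have "unit_code (R ` S)"
    using S(2) unfolding unit_code_def by (auto simp: R(1) simp del: split_paired_All)
  moreover have "0 < snd w" if "w \<in> R ` S" for w
    using q(2) that by (auto simp: R(2) simp del: split_paired_All)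
  ultimately have "card S \<le> sph_max_ge TYPE('m) (arccos (3 / 4)) + 1"
    using card_unit_code_le[OF card, of "R ` S"] S(1) by simp
  then show "enat (card S) \<le> enat (sph_max_ge TYPE('m) (arccos (3 / 4)) + 1)"
    by simp
qed

section \<open>The comparison of the kissing numbers\<close>

theorem theorem4p6:
  assumes "CARD('n::finite) \<ge> 2" and "CARD('m::finite) = CARD('n) - 1"
  shows "strict_hyp_kissing TYPE('n) (pi / 2) \<le> hyp_kissing TYPE('n) (pi / 2) \<and>
         hyp_kissing TYPE('n) (pi / 2) \<le> 2 * strict_hyp_kissing TYPE('n) (pi / 2) \<and>
         (\<forall>\<phi> \<tau> \<phi>\<^sub>0 :: real.
            0 < \<phi> \<and> \<phi> < \<tau> \<and> \<tau> \<le> pi \<and> sqrt 2 * sin (\<phi> / 2) = sin (\<tau> / 2) \<and> \<phi>\<^sub>0 = arccos (3 / 4) \<longrightarrow>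
            enat (max (sph_max_ge TYPE('m) (2 * \<phi>\<^sub>0) div 2) (sph_max TYPE('m) \<phi> \<tau>))
              \<le> strict_hyp_kissing TYPE('n) (pi / 2) \<and>
            strict_hyp_kissing TYPE('n) (pi / 2) \<le> enat (sph_max_ge TYPE('m) \<phi>\<^sub>0 + 2))"
proof (intro conjI allI impI; (elim conjE)?)
  show "strict_hyp_kissing TYPE('n) (pi / 2) \<le> hyp_kissing TYPE('n) (pi / 2)"
    by (rule strict_hyp_kissing_le_hyp_kissing)
  show "hyp_kissing TYPE('n) (pi / 2) \<le> 2 * strict_hyp_kissing TYPE('n) (pi / 2)"
    by (rule hyp_kissing_le_twice_strict)
  fix \<phi> \<tau> \<phi>\<^sub>0 :: real
  assume a: "0 < \<phi>" "\<phi> < \<tau>" "\<tau> \<le> pi" "sqrt 2 * sin (\<phi> / 2) = sin (\<tau> / 2)"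
    and \<phi>\<^sub>0: "\<phi>\<^sub>0 = arccos (3 / 4)"
  show "enat (max (sph_max_ge TYPE('m) (2 * \<phi>\<^sub>0) div 2) (sph_max TYPE('m) \<phi> \<tau>))
      \<le> strict_hyp_kissing TYPE('n) (pi / 2)"
    using half_sph_max_le_strict_hyp_kissing[OF assms(2)] sph_max_le_strict_hyp_kissing[OF assms(2) a]
    by (simp add: \<phi>\<^sub>0 max_def)
  have "strict_hyp_kissing TYPE('n) (pi / 2) \<le> enat (sph_max_ge TYPE('m) \<phi>\<^sub>0 + 1)"
    unfolding \<phi>\<^sub>0 by (rule strict_hyp_kissing_le_sph_max[OF assms(2)])
  also have "\<dots> \<le> enat (sph_max_ge TYPE('m) \<phi>\<^sub>0 + 2)"
    by simp
  finally show "strict_hyp_kissing TYPE('n) (pi / 2) \<le> enat (sph_max_ge TYPE('m) \<phi>\<^sub>0 + 2)" .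
qed

end
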